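(* The functor $\mathrm{Prim}$ preserves the 2-crossed module structure: if $K\xrightarrow{\partial_2}I\xrightarrow{\partial_1}H$ is a 2-crossed module of cocommutative Hopf algebras over $\kappa$, with actions $\vartriangleright_\rho$ and Peiffer lifting $\{\ ,\ \}$, then $\mathrm{Prim}(K)\xrightarrow{\partial_2}\mathrm{Prim}(I)\xrightarrow{\partial_1}\mathrm{Prim}(H)$, with the restricted maps, actions and Peiffer lifting, is a 2-crossed module of Lie algebras.
   Context: All Hopf algebras are cocommutative over an arbitrary field $\kappa$, with coproduct $\delta(x)=\sum_{(x)}x'\otimes x''$ (iterated: $x',x'',x''',\dots$), counit $\epsilon$, antipode $S$. The zero morphism $A\to B$ is $x\mapsto\epsilon(x)1_B$. Adjoint action: $x\vartriangleright_{ad}y=\sum_{(x)}x'\,y\,S(x'')$. $\mathrm{Prim}(H)=\{x\in H:\delta(x)=x\otimes1_H+1_H\otimes x\}$ is a Lie algebra under $[x,y]=xy-yx$. An $H$-module bialgebra $I$ is a bialgebra with an $H$-module structure $\vartriangleright_\rho\colon H\otimes I\to I$ such that $x\vartriangleright_\rho 1=\epsilon(x)1$, $x\vartriangleright_\rho(uv)=\sum(x'\vartriangleright_\rho u)(x''\vartriangleright_\rho v)$, $\delta(x\vartriangleright_\rho v)=\sum(x'\vartriangleright_\rho v')\otimes(x''\vartriangleright_\rho v'')$, $\epsilon(x\vartriangleright_\rho v)=\epsilon(x)\epsilon(v)$. A crossed module of Hopf algebras is a Hopf algebra map $\partial\colon I\to H$ with an $H$-module bialgebra structure on $I$ such that $\partial(x\vartriangleright_\rho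 v)=x\vartriangleright_{ad}\partial(v)$ and $\partial(u)\vartriangleright_\rho v=u\vartriangleright_{ad}v$ for $x\in H$, $u,v\in I$. A 2-crossed module of Hopf algebras is a chain complex $K\xrightarrow{\partial_2}I\xrightarrow{\partial_1}H$ of Hopf algebras ($\partial_1\partial_2$ is the zero morphism) with actions $\vartriangleright_\rho$ of $H$ on $I$ and $K$, and on itself by the adjoint action, together with a bilinear map (Peiffer lifting) $\{\ ,\ \}$ from pairs of elements of $I$ to $K$ which is $H$-equivariant, i.e. $a\vartriangleright_\rho\{x,y\}=\sum_{(a)}\{a'\vartriangleright_\rho x,a''\vartriangleright_\rho y\}$, such that for all $x,y,z\in I$, $k,l\in K$: 1) it is a complex of $H$-module bialgebras: $\partial_2(a\vartriangleright_\rho k)=a\vartriangleright_\rho\partial_2(k)$ and $\partial_1(a\vartriangleright_\rho x)=a\vartriangleright_{ad}\partial_1(x)$ for $a\in H$; 2) $\partial_2\{x,y\}=\sum_{(x)(y)}(x'\vartriangleright_{ad}y')\,\big(\partial_1(x'')\vartriangleright_\rho S(y'')\big)$; 3) $\{\partial_2(k),\partial_2(l)\}=\sum_{(l)}(k\vartriangleright_{ad}l')\,S(l'')$; 4) $\{x,yz\}=\sum_{(x)(y)}\{x',y'\}\,\big((\partial_1(x'')\vartriangleright_\rho y'')\vartriangleright'_\rho\{x''',z\}\big)$; 5) $\{xy,z\}=\sum_{(x)(y)(z)}\{x',y'\vartriangleright_{ad}z'\}\,\big(\partial_1(x'')\vartriangleright_\rho\{y'',z''\}\big)$; 6) $\sum_{(k)(x)}\{\partial_2(k'),x'\}\{x'',\partial_2(k'')\}=\sum_{(k)}k'\,\big(\partial_1(x)\vartriangleright_\rho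 S(k'')\big)$; where in 4) the action of $I$ on $K$ is $x\vartriangleright'_\rho k=\sum_{(k)}k'\,\{\partial_2(S(k'')),x\}$, such that $(\partial_2\colon K\to I,\vartriangleright'_\rho)$ becomes a crossed module. A crossed module of Lie algebras is a Lie algebra map $\partial\colon\mathfrak e\to\mathfrak g$ with an action $\triangleright$ of $\mathfrak g$ on $\mathfrak e$ by derivations such that $\partial(g\triangleright e)=[g,\partial(e)]$ and $\partial(e)\triangleright f=[e,f]$. A 2-crossed module of Lie algebras is a chain complex of Lie algebras $\mathfrak l\xrightarrow{\partial_2}\mathfrak e\xrightarrow{\partial_1}\mathfrak g$ with left actions $\triangleright$ of $\mathfrak g$ on $\mathfrak e,\mathfrak l$ and a bilinear map $\{\ ,\ \}$ from pairs of elements of $\mathfrak e$ to $\mathfrak l$, which is $\mathfrak g$-equivariant ($g\triangleright\{u,v\}=\{g\triangleright u,v\}+\{u,g\triangleright v\}$), such that for all $x,y\in\mathfrak l$, $u,v,w\in\mathfrak e$: 1) it is a complex of $\mathfrak g$-modules, with $\mathfrak g$ acting on itself by the adjoint representation; 2) $\partial_2\{u,v\}=[u,v]-\partial_1(u)\triangleright v$; 3) $\{\partial_2(x),\partial_2(y)\}=[x,y]$; 4) $\{u,[v,w]\}=\{\partial_2\{u,v\},w\}-\{\partial_2\{u,w\},v\}$; 5) $\{[u,v],w\}=\partial_1(u)\triangleright\{v,w\}+\{u,[v,w]\}-\partial_1(v)\triangleright\{u,w\}-\{v,[u,w]\}$; 6) $\{\partial_2(x),v\}+\{v,\partial_2(x)\}=-\partial_1(v)\triangleright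 x$. Putting $v\triangleright'x=-\{\partial_2(x),v\}$ turns $(\partial_2\colon\mathfrak l\to\mathfrak e,\triangleright')$ into a crossed module of Lie algebras.
   Formalization: The Peiffer lifting is additionally required to be a coalgebra morphism from I⊗I to K (compatible with coproduct and counit); if it is merely bilinear, it need not send primitive elements to primitive elements and the claim fails. *)

theory Defs
  imports Complex_Main
begin

section \<open>Tensor powers\<close>

text \<open>
  A list of words over a vector space denotes a formal sum of pure tensors: the list
  \<open>[[a, b], [c, d]]\<close> stands for \<open>a \<otimes> b + c \<otimes> d\<close>. Two lists of words of length \<open>n\<close> are related
  iff they denote the same element of the \<open>n\<close>-th tensor power over the base field: this power is
  the free commutative monoid on the words modulo additivity in every slot and moving scalars
  between slots. (Negatives exist because of the rule \<open>zero\<close>; scalars act on any one slot.)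
\<close>

inductive tensor_eq :: "('k::field \<Rightarrow> 'a::ab_group_add \<Rightarrow> 'a) \<Rightarrow> 'a list list \<Rightarrow> 'a list list \<Rightarrow> bool"
  for s where
  refl: "tensor_eq s t t"
| sym: "tensor_eq s t u \<Longrightarrow> tensor_eq s u t"
| trans: "tensor_eq s t u \<Longrightarrow> tensor_eq s u v \<Longrightarrow> tensor_eq s t v"
| comm: "tensor_eq s (t @ u) (u @ t)"
| sum: "tensor_eq s t t' \<Longrightarrow> tensor_eq s u u' \<Longrightarrow> tensor_eq s (t @ u) (t' @ u')"
| zero: "tensor_eq s [p @ 0 # q] []"
| add: "tensor_eq s [p @ (x + y) # q] [p @ x # q, p @ y # q]"
| scale: "tensor_eq s [p @ s c x # q @ y # r] [p @ x # q @ s c y # r]"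

definition tensor2_eq :: "('k::field \<Rightarrow> 'a::ab_group_add \<Rightarrow> 'a) \<Rightarrow> ('a \<times> 'a) list \<Rightarrow> ('a \<times> 'a) list \<Rightarrow> bool" where
  "tensor2_eq s t u \<longleftrightarrow> tensor_eq s [[x, y]. (x, y) \<leftarrow> t] [[x, y]. (x, y) \<leftarrow> u]"

definition tensor3_eq :: "('k::field \<Rightarrow> 'a::ab_group_add \<Rightarrow> 'a) \<Rightarrow> ('a \<times> 'a \<times> 'a) list \<Rightarrow> ('a \<times> 'a \<times> 'a) list \<Rightarrow> bool" where
  "tensor3_eq s t u \<longleftrightarrow> tensor_eq s [[x, y, z]. (x, y, z) \<leftarrow> t] [[x, y, z]. (x, y, z) \<leftarrow> u]"

definition bilinear_map ::
  "('k::field \<Rightarrow> 'a::ab_group_add \<Rightarrow> 'a) \<Rightarrow> ('k \<Rightarrow> 'b::ab_group_add \<Rightarrow> 'b) \<Rightarrow> ('k \<Rightarrow> 'c::ab_group_add \<Rightarrow> 'c)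
    \<Rightarrow> ('a \<Rightarrow> 'b \<Rightarrow> 'c) \<Rightarrow> bool" where
  "bilinear_map s1 s2 s3 f \<longleftrightarrow>
     (\<forall>x. Vector_Spaces.linear s2 s3 (f x)) \<and> (\<forall>y. Vector_Spaces.linear s1 s3 (\<lambda>x. f x y))"

section \<open>Cocommutative Hopf algebras\<close>

text \<open>
  The underlying ring is given by the type class. The coproduct is given by a list \<open>coprod A x\<close> of
  pairs representing \<open>\<delta>(x) = \<Sum> x' \<otimes> x''\<close>; the choice of representatives is arbitrary, and all
  conditions below depend only on the tensors that are represented. A Sweedler sum is thus a sum
  over such a list, its summand being multilinear in the components.
\<close>

record ('k, 'a) hopf =
  smul :: "'k \<Rightarrow> 'a \<Rightarrow> 'a"
  coprod :: "'a \<Rightarrow> ('a \<times> 'a) list"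
  counit :: "'a \<Rightarrow> 'k"
  antipode :: "'a \<Rightarrow> 'a"

definition coprod3 :: "('k, 'a) hopf \<Rightarrow> 'a \<Rightarrow> ('a \<times> 'a \<times> 'a) list" where
  "coprod3 A x = [(x1, x2, x3). (x1, y) \<leftarrow> coprod A x, (x2, x3) \<leftarrow> coprod A y]"

text \<open>The field \<open>antipode\<close> is not constrained by this locale.\<close>

locale bialgebra =
  fixes A :: "('k::field, 'a::ring_1) hopf"
  assumes vector_space: "vector_space (smul A)"
    and smul_mult_left: "smul A c (x * y) = smul A c x * y"
    and smul_mult_right: "smul A c (x * y) = x * smul A c y"
    and coprod_add: "tensor2_eq (smul A) (coprod A (x + y)) (coprod A x @ coprod A y)"
    and coprod_smul: "tensor2_eq (smul A) (coprod A (smul A c x)) [(smul A c x1, x2). (x1, x2) \<leftarrow> coprod A x]"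
    and counit_linear: "Vector_Spaces.linear (smul A) (*) (counit A)"
    and coassoc: "tensor3_eq (smul A)
          [(x1, x2, x3). (y, x3) \<leftarrow> coprod A x, (x1, x2) \<leftarrow> coprod A y]
          [(x1, x2, x3). (x1, y) \<leftarrow> coprod A x, (x2, x3) \<leftarrow> coprod A y]"
    and counit_left: "(\<Sum>(x1, x2)\<leftarrow>coprod A x. smul A (counit A x1) x2) = x"
    and counit_right: "(\<Sum>(x1, x2)\<leftarrow>coprod A x. smul A (counit A x2) x1) = x"
    and coprod_one: "tensor2_eq (smul A) (coprod A 1) [(1, 1)]"
    and coprod_mult: "tensor2_eq (smul A) (coprod A (x * y))
          [(x1 * y1, x2 * y2). (x1, x2) \<leftarrow> coprod A x, (y1, y2) \<leftarrow> coprod A y]"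
    and counit_one: "counit A 1 = 1"
    and counit_mult: "counit A (x * y) = counit A x * counit A y"

locale cocomm_hopf_algebra = bialgebra A
  for A :: "('k::field, 'a::ring_1) hopf" +
  assumes cocomm: "tensor2_eq (smul A) (coprod A x) [(x2, x1). (x1, x2) \<leftarrow> coprod A x]"
    and antipode_linear: "Vector_Spaces.linear (smul A) (smul A) (antipode A)"
    and antipode_left: "(\<Sum>(x1, x2)\<leftarrow>coprod A x. antipode A x1 * x2) = smul A (counit A x) 1"
    and antipode_right: "(\<Sum>(x1, x2)\<leftarrow>coprod A x. x1 * antipode A x2) = smul A (counit A x) 1"

text \<open>Bialgebra maps between Hopf algebras; these commute with the antipodes automatically.\<close>

locale hopf_hom = A: cocomm_hopf_algebra A + B: cocomm_hopf_algebra B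
  for A :: "('k::field, 'a::ring_1) hopf" and B :: "('k, 'b::ring_1) hopf" +
  fixes f :: "'a \<Rightarrow> 'b"
  assumes linear: "Vector_Spaces.linear (smul A) (smul B) f"
    and one: "f 1 = 1"
    and mult: "f (x * y) = f x * f y"
    and coprod: "tensor2_eq (smul B) (coprod B (f x)) [(f x1, f x2). (x1, x2) \<leftarrow> coprod A x]"
    and counit: "counit B (f x) = counit A x"

definition ad :: "('k, 'a::ring_1) hopf \<Rightarrow> 'a \<Rightarrow> 'a \<Rightarrow> 'a" where
  "ad A x y = (\<Sum>(x1, x2)\<leftarrow>coprod A x. x1 * y * antipode A x2)"

locale module_bialgebra = H: cocomm_hopf_algebra H + I: bialgebra I
  for H :: "('k::field, 'h::ring_1) hopf" and I :: "('k, 'i::ring_1) hopf" +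
  fixes act :: "'h \<Rightarrow> 'i \<Rightarrow> 'i"
  assumes act_bilinear: "bilinear_map (smul H) (smul I) (smul I) act"
    and one_act: "act 1 v = v"
    and mult_act: "act (x * y) v = act x (act y v)"
    and act_one: "act x 1 = smul I (counit H x) 1"
    and act_mult: "act x (u * v) = (\<Sum>(x1, x2)\<leftarrow>coprod H x. act x1 u * act x2 v)"
    and act_coprod: "tensor2_eq (smul I) (coprod I (act x v))
          [(act x1 v1, act x2 v2). (x1, x2) \<leftarrow> coprod H x, (v1, v2) \<leftarrow> coprod I v]"
    and act_counit: "counit I (act x v) = counit H x * counit I v"

locale hopf_crossed_module = hopf_hom I H d + module_bialgebra H I act
  for I :: "('k::field, 'i::ring_1) hopf" and H :: "('k, 'h::ring_1) hopf"
    and d :: "'i \<Rightarrow> 'h" and act :: "'h \<Rightarrow> 'i \<Rightarrow> 'i" +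
  assumes d_act: "d (act x v) = ad H x (d v)"
    and peiffer: "act (d u) v = ad I u v"

section \<open>2-crossed modules of Hopf algebras\<close>

definition lifting_action ::
  "('k, 'l::ring_1) hopf \<Rightarrow> ('l \<Rightarrow> 'i) \<Rightarrow> ('i \<Rightarrow> 'i \<Rightarrow> 'l) \<Rightarrow> 'i \<Rightarrow> 'l \<Rightarrow> 'l" where
  "lifting_action K d2 lift x k = (\<Sum>(k1, k2)\<leftarrow>coprod K k. k1 * lift (d2 (antipode K k2)) x)"

text \<open>
  The Peiffer lifting is, like every structure map here, a morphism of coalgebras
  (from \<open>I \<otimes> I\<close> to \<open>K\<close>), which is \<open>lift_coprod\<close> and \<open>lift_counit\<close>. Bilinearity and the other
  conditions imply \<open>lift_counit\<close> but not \<open>lift_coprod\<close>, without which the lifting need not restrict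
  to primitive elements: in characteristic 0 take for \<open>H\<close> the base field, \<open>I\<close> and \<open>K\<close> the polynomial
  Hopf algebras in primitive variables \<open>t\<close> and \<open>s\<close>, zero morphisms, the trivial action, and
  the lifting sending \<open>(t^m, t^n)\<close> to \<open>n! s^(2n)\<close> if \<open>m = n\<close> and to 0 otherwise. All other
  conditions hold, but \<open>(t, t)\<close> is sent to \<open>s^2\<close>.
\<close>

locale hopf_two_crossed_module =
  d2: hopf_hom K I d2 + d1: hopf_hom I H d1 +
  actI: module_bialgebra H I actI + actK: module_bialgebra H K actK
  for K :: "('k::field, 'l::ring_1) hopf" and I :: "('k, 'i::ring_1) hopf"
    and H :: "('k, 'h::ring_1) hopf"
    and d2 :: "'l \<Rightarrow> 'i" and d1 :: "'i \<Rightarrow> 'h"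
    and actI :: "'h \<Rightarrow> 'i \<Rightarrow> 'i" and actK :: "'h \<Rightarrow> 'l \<Rightarrow> 'l" +
  fixes lift :: "'i \<Rightarrow> 'i \<Rightarrow> 'l"
  assumes complex: "d1 (d2 k) = smul H (counit K k) 1"
    and lift_bilinear: "bilinear_map (smul I) (smul I) (smul K) lift"
    and lift_coprod: "tensor2_eq (smul K) (coprod K (lift x y))
          [(lift x1 y1, lift x2 y2). (x1, x2) \<leftarrow> coprod I x, (y1, y2) \<leftarrow> coprod I y]"
    and lift_counit: "counit K (lift x y) = counit I x * counit I y"
    and lift_equivariant:
      "actK a (lift x y) = (\<Sum>(a1, a2)\<leftarrow>coprod H a. lift (actI a1 x) (actI a2 y))"
    and d2_act: "d2 (actK a k) = actI a (d2 k)"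
    and d1_act: "d1 (actI a x) = ad H a (d1 x)"
    and d2_lift: "d2 (lift x y) =
          (\<Sum>(x1, x2)\<leftarrow>coprod I x. \<Sum>(y1, y2)\<leftarrow>coprod I y.
             ad I x1 y1 * actI (d1 x2) (antipode I y2))"
    and lift_d2_d2: "lift (d2 k) (d2 l) = (\<Sum>(l1, l2)\<leftarrow>coprod K l. ad K k l1 * antipode K l2)"
    and lift_mult_right: "lift x (y * z) =
          (\<Sum>(x1, x2, x3)\<leftarrow>coprod3 I x. \<Sum>(y1, y2)\<leftarrow>coprod I y.
             lift x1 y1 * lifting_action K d2 lift (actI (d1 x2) y2) (lift x3 z))"
    and lift_mult_left: "lift (x * y) z =
          (\<Sum>(x1, x2)\<leftarrow>coprod I x. \<Sum>(y1, y2)\<leftarrow>coprod I y. \<Sum>(z1, z2)\<leftarrow>coprod I z.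
             lift x1 (ad I y1 z1) * actK (d1 x2) (lift y2 z2))"
    and lift_d2_sym:
      "(\<Sum>(k1, k2)\<leftarrow>coprod K k. \<Sum>(x1, x2)\<leftarrow>coprod I x. lift (d2 k1) x1 * lift x2 (d2 k2)) =
       (\<Sum>(k1, k2)\<leftarrow>coprod K k. k1 * actK (d1 x) (antipode K k2))"
    and lifting_action_crossed_module: "hopf_crossed_module K I d2 (lifting_action K d2 lift)"

section \<open>2-crossed modules of Lie algebras\<close>

text \<open>A Lie algebra lives on a subspace of an ambient vector space.\<close>

record ('k, 'a) lie =
  lcarrier :: "'a set"
  lscale :: "'k \<Rightarrow> 'a \<Rightarrow> 'a"
  bracket :: "'a \<Rightarrow> 'a \<Rightarrow> 'a"

definition lie_linear :: "('k, 'a::ab_group_add) lie \<Rightarrow> ('k, 'b::ab_group_add) lie \<Rightarrow> ('a \<Rightarrow> 'b) \<Rightarrow> bool" where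
  "lie_linear L M f \<longleftrightarrow>
     (\<forall>x\<in>lcarrier L. f x \<in> lcarrier M) \<and>
     (\<forall>x\<in>lcarrier L. \<forall>y\<in>lcarrier L. f (x + y) = f x + f y) \<and>
     (\<forall>c. \<forall>x\<in>lcarrier L. f (lscale L c x) = lscale M c (f x))"

definition lie_bilinear ::
  "('k, 'a::ab_group_add) lie \<Rightarrow> ('k, 'b::ab_group_add) lie \<Rightarrow> ('k, 'c::ab_group_add) lie
    \<Rightarrow> ('a \<Rightarrow> 'b \<Rightarrow> 'c) \<Rightarrow> bool" where
  "lie_bilinear L M N f \<longleftrightarrow>
     (\<forall>x\<in>lcarrier L. lie_linear M N (f x)) \<and> (\<forall>y\<in>lcarrier M. lie_linear L N (\<lambda>x. f x y))"

locale lie_algebra =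
  fixes L :: "('k::field, 'a::ab_group_add) lie"
  assumes vector_space: "vector_space (lscale L)"
    and subspace: "module.subspace (lscale L) (lcarrier L)"
    and bracket_bilinear: "lie_bilinear L L L (bracket L)"
    and bracket_self: "x \<in> lcarrier L \<Longrightarrow> bracket L x x = 0"
    and jacobi: "x \<in> lcarrier L \<Longrightarrow> y \<in> lcarrier L \<Longrightarrow> z \<in> lcarrier L \<Longrightarrow>
      bracket L x (bracket L y z) + bracket L y (bracket L z x) + bracket L z (bracket L x y) = 0"

locale lie_hom = A: lie_algebra A + B: lie_algebra B
  for A :: "('k::field, 'a::ab_group_add) lie" and B :: "('k, 'b::ab_group_add) lie" +
  fixes f :: "'a \<Rightarrow> 'b"
  assumes linear: "lie_linear A B f"
    and hom_bracket: "x \<in> lcarrier A \<Longrightarrow> y \<in> lcarrier A \<Longrightarrow>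
      f (bracket A x y) = bracket B (f x) (f y)"

locale lie_action = G: lie_algebra G + E: lie_algebra E
  for G :: "('k::field, 'g::ab_group_add) lie" and E :: "('k, 'e::ab_group_add) lie" +
  fixes act :: "'g \<Rightarrow> 'e \<Rightarrow> 'e"
  assumes act_bilinear: "lie_bilinear G E E act"
    and bracket_act: "g \<in> lcarrier G \<Longrightarrow> h \<in> lcarrier G \<Longrightarrow> x \<in> lcarrier E \<Longrightarrow>
      act (bracket G g h) x = act g (act h x) - act h (act g x)"
    and act_bracket: "g \<in> lcarrier G \<Longrightarrow> x \<in> lcarrier E \<Longrightarrow> y \<in> lcarrier E \<Longrightarrow>
      act g (bracket E x y) = bracket E (act g x) y + bracket E x (act g y)"

locale lie_two_crossed_module =
  d2: lie_hom L E d2 + d1: lie_hom E G d1 +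
  actE: lie_action G E actE + actL: lie_action G L actL
  for L :: "('k::field, 'l::ab_group_add) lie" and E :: "('k, 'e::ab_group_add) lie"
    and G :: "('k, 'g::ab_group_add) lie"
    and d2 :: "'l \<Rightarrow> 'e" and d1 :: "'e \<Rightarrow> 'g"
    and actE :: "'g \<Rightarrow> 'e \<Rightarrow> 'e" and actL :: "'g \<Rightarrow> 'l \<Rightarrow> 'l" +
  fixes lift :: "'e \<Rightarrow> 'e \<Rightarrow> 'l"
  assumes complex: "x \<in> lcarrier L \<Longrightarrow> d1 (d2 x) = 0"
    and lift_bilinear: "lie_bilinear E E L lift"
    and lift_equivariant: "g \<in> lcarrier G \<Longrightarrow> u \<in> lcarrier E \<Longrightarrow> v \<in> lcarrier E \<Longrightarrow>
      actL g (lift u v) = lift (actE g u) v + lift u (actE g v)"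
    and d2_act: "g \<in> lcarrier G \<Longrightarrow> x \<in> lcarrier L \<Longrightarrow> d2 (actL g x) = actE g (d2 x)"
    and d1_act: "g \<in> lcarrier G \<Longrightarrow> u \<in> lcarrier E \<Longrightarrow> d1 (actE g u) = bracket G g (d1 u)"
    and d2_lift: "u \<in> lcarrier E \<Longrightarrow> v \<in> lcarrier E \<Longrightarrow>
      d2 (lift u v) = bracket E u v - actE (d1 u) v"
    and lift_d2_d2: "x \<in> lcarrier L \<Longrightarrow> y \<in> lcarrier L \<Longrightarrow>
      lift (d2 x) (d2 y) = bracket L x y"
    and lift_bracket_right: "u \<in> lcarrier E \<Longrightarrow> v \<in> lcarrier E \<Longrightarrow> w \<in> lcarrier E \<Longrightarrow>
      lift u (bracket E v w) = lift (d2 (lift u v)) w - lift (d2 (lift u w)) v"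
    and lift_bracket_left: "u \<in> lcarrier E \<Longrightarrow> v \<in> lcarrier E \<Longrightarrow> w \<in> lcarrier E \<Longrightarrow>
      lift (bracket E u v) w =
        actL (d1 u) (lift v w) + lift u (bracket E v w) - actL (d1 v) (lift u w) - lift v (bracket E u w)"
    and lift_d2_sym: "x \<in> lcarrier L \<Longrightarrow> v \<in> lcarrier E \<Longrightarrow>
      lift (d2 x) v + lift v (d2 x) = - actL (d1 v) x"

section \<open>Primitive elements\<close>

definition Prim :: "('k::field, 'a::ring_1) hopf \<Rightarrow> ('k, 'a) lie" where
  "Prim A = \<lparr>lcarrier = {x. tensor2_eq (smul A) (coprod A x) [(x, 1), (1, x)]},
     lscale = smul A, bracket = (\<lambda>x y. x * y - y * x)\<rparr>"

end

theory Submission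
  imports Defs "HOL-Library.Multiset"
begin

text \<open>
  If \<open>x\<close> is primitive, a Sweedler sum of a multilinear expression over the coproduct of \<open>x\<close> has one
  summand for each leg: that leg carries \<open>x\<close> and all others carry \<open>1\<close>. Evaluated in this way on
  primitive elements, each Hopf axiom becomes an identity with few summands. Most of these vanish,
  because the actions and the lifting give \<open>0\<close> when applied to a primitive element and \<open>1\<close>, apart
  from \<open>1\<close> acting as the identity; the survivors form the Lie axiom. For the actions this vanishing
  is \<open>x \<rhd> 1 = \<epsilon>(x) 1 = 0\<close>.

  For the Peiffer lifting it has to be extracted from the axioms (\<open>lift_one_one\<close>,
  \<open>lift_one_right_Prim\<close>, \<open>lift_one_left_Prim\<close>): \<open>{1, 1} = 1\<close> is the formula for
  \<open>{\<partial>\<^sub>2 k, \<partial>\<^sub>2 l}\<close> at \<open>k = l = 1\<close>; the formula for \<open>{x, yz}\<close> at \<open>y = z = 1\<close> reads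
  \<open>{x, 1} = {x, 1} + {x, 1}\<close> for primitive \<open>x\<close>, whence \<open>{x, 1} = 0\<close>; and the formula for
  \<open>\<Sum> {\<partial>\<^sub>2 k', x'} {x'', \<partial>\<^sub>2 k''}\<close> at \<open>k = 1\<close> then gives \<open>{1, x} = 0\<close>. The same normalisation shows
  that the lifting of primitive elements is primitive: of the four terms of the coproduct
  \<open>\<Sum> {x', y'} \<otimes> {x'', y''}\<close> of \<open>{x, y}\<close> only \<open>{x, y} \<otimes> 1\<close> and \<open>1 \<otimes> {x, y}\<close> remain
  (\<open>Prim_bilinear_image\<close>, which serves the actions too).

  For the two bracket axioms, evaluation on primitive elements gives
  \<open>{x, yz} = - {\<partial>\<^sub>2{x, z}, y}\<close> and \<open>{xy, z} = {x, [y, z]} + \<partial>\<^sub>1(x) \<rhd> {y, z}\<close>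
  (\<open>lift_mult_right_Prim\<close>, \<open>lift_mult_left_Prim\<close>), and one antisymmetrises.
\<close>

section \<open>Formal sums of tensors\<close>

lemma linear_simps:
  assumes "Vector_Spaces.linear s1 s2 f"
  shows "f 0 = 0" "f (x + y) = f x + f y" "f (x - y) = f x - f y" "f (- x) = - f x"
    "f (s1 c x) = s2 c (f x)"
proof -
  interpret Vector_Spaces.linear s1 s2 f by fact
  show "f 0 = 0" "f (x + y) = f x + f y" "f (x - y) = f x - f y" "f (- x) = - f x"
    "f (s1 c x) = s2 c (f x)"
    by (simp_all add: zero add diff neg scale)
qed

lemma bilinear_simps:
  assumes "bilinear_map s1 s2 s3 f"
  shows "f 0 y = 0" "f x 0 = 0" "f (x + x') y = f x y + f x' y" "f x (y + y') = f x y + f x y'"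
    "f (x - x') y = f x y - f x' y" "f x (y - y') = f x y - f x y'"
    "f (- x) y = - f x y" "f x (- y) = - f x y"
    "f (s1 c x) y = s3 c (f x y)" "f x (s2 c y) = s3 c (f x y)"
  using assms linear_simps[of s2 s3 "f x"] linear_simps[of s1 s3 "\<lambda>x. f x y"]
  by (simp_all add: bilinear_map_def)

lemma tensor_eq_permute:
  assumes "mset t = mset u"
  shows "tensor_eq s t u"
  using assms
proof (induction t arbitrary: u)
  case Nil
  then show ?case by (simp add: tensor_eq.refl)
next
  case (Cons a t)
  then have "a \<in> set u"
    by (metis list.set_intros(1) set_mset_mset)
  then obtain p q where u: "u = p @ a # q"
    by (meson split_list)
  have "tensor_eq s t (q @ p)"
    using Cons u by simp
  from tensor_eq.sum[OF tensor_eq.refl this, of "[a]"]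
  have "tensor_eq s (a # t) ((a # q) @ p)"
    by simp
  moreover have "tensor_eq s ((a # q) @ p) (p @ a # q)"
    by (rule tensor_eq.comm)
  ultimately show ?case
    unfolding u by (rule tensor_eq.trans)
qed

lemma tensor2_eq_iff_map:
  "tensor2_eq s t u \<longleftrightarrow> tensor_eq s (map (\<lambda>(x, y). [x, y]) t) (map (\<lambda>(x, y). [x, y]) u)"
proof -
  have "concat (map (\<lambda>(x, y). [[x, y]]) t) = map (\<lambda>(x, y). [x, y]) t" for t :: "('a \<times> 'a) list"
    by (induction t) auto
  then show ?thesis
    by (simp add: tensor2_eq_def)
qed

lemma tensor2_eq_refl [simp]: "tensor2_eq s t t"
  by (simp add: tensor2_eq_iff_map tensor_eq.refl)

lemma tensor2_eq_sym: "tensor2_eq s t u \<Longrightarrow> tensor2_eq s u t"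
  by (simp add: tensor2_eq_iff_map tensor_eq.sym)

lemma tensor2_eq_trans [trans]: "tensor2_eq s t u \<Longrightarrow> tensor2_eq s u v \<Longrightarrow> tensor2_eq s t v"
  unfolding tensor2_eq_iff_map by (rule tensor_eq.trans)

lemma tensor2_eq_append:
  "tensor2_eq s t t' \<Longrightarrow> tensor2_eq s u u' \<Longrightarrow> tensor2_eq s (t @ u) (t' @ u')"
  by (simp add: tensor2_eq_iff_map tensor_eq.sum)

lemma tensor2_eq_permute: "mset t = mset u \<Longrightarrow> tensor2_eq s t u"
  by (simp add: tensor2_eq_iff_map tensor_eq_permute)

lemma tensor2_eq_Cons: "tensor2_eq s t u \<Longrightarrow> tensor2_eq s (p # t) (p # u)"
  using tensor2_eq_append[of s "[p]" "[p]" t u] by simp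

lemma tensor2_eq_concat_map:
  "(\<And>p. p \<in> set t \<Longrightarrow> tensor2_eq s (f p) (g p)) \<Longrightarrow>
    tensor2_eq s (concat (map f t)) (concat (map g t))"
  by (induction t) (simp_all add: tensor2_eq_append)

lemma tensor2_eq_zero_left: "tensor2_eq s [(0, y)] []"
  using tensor_eq.zero[of s "[]" "[y]"] by (simp add: tensor2_eq_iff_map)

lemma tensor2_eq_zero_right: "tensor2_eq s [(x, 0)] []"
  using tensor_eq.zero[of s "[x]" "[]"] by (simp add: tensor2_eq_iff_map)

lemma tensor2_eq_add_left: "tensor2_eq s [(x + y, z)] [(x, z), (y, z)]"
  using tensor_eq.add[of s "[]" x y "[z]"] by (simp add: tensor2_eq_iff_map)

lemma tensor2_eq_add_right: "tensor2_eq s [(z, x + y)] [(z, x), (z, y)]"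
  using tensor_eq.add[of s "[z]" x y "[]"] by (simp add: tensor2_eq_iff_map)

lemma tensor2_eq_scale: "tensor2_eq s [(s c x, y)] [(x, s c y)]"
  using tensor_eq.scale[of s "[]" c x "[]" y "[]"] by (simp add: tensor2_eq_iff_map)

text \<open>
  These are the maps that induce an additive map on the tensor square, so that a Sweedler sum with
  such a summand depends only on the tensor. Scalars are merely moved between the two slots, since
  the target carries no scalar multiplication.
\<close>

definition balanced :: "('k \<Rightarrow> 'a::ab_group_add \<Rightarrow> 'a) \<Rightarrow> ('a \<Rightarrow> 'a \<Rightarrow> 'b::ab_group_add) \<Rightarrow> bool" where
  "balanced s F \<longleftrightarrow>
     (\<forall>x y z. F (x + y) z = F x z + F y z) \<and> (\<forall>x y z. F x (y + z) = F x y + F x z) \<and>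
     (\<forall>c x y. F (s c x) y = F x (s c y))"

lemma balancedI:
  assumes "\<And>x y z. F (x + y) z = F x z + F y z" "\<And>x y z. F x (y + z) = F x y + F x z"
    "\<And>c x y. F (s c x) y = F x (s c y)"
  shows "balanced s F"
  using assms by (simp add: balanced_def)

text \<open>
  The summand is extended by \<open>0\<close> to words of length other than 2, through which an equivalence of
  formal sums may pass; each generating relation of the tensor power then preserves the sum.
\<close>

lemma balanced_sum_eq:
  assumes F: "balanced s F" and "tensor2_eq s t u"
  shows "(\<Sum>(x, y)\<leftarrow>t. F x y) = (\<Sum>(x, y)\<leftarrow>u. F x y)"
proof -
  define W where "W = (\<lambda>w. case w of [x, y] \<Rightarrow> F x y | _ \<Rightarrow> 0)"
  have add: "F (x + y) z = F x z + F y z" "F z (x + y) = F z x + F z y" for x y z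
    using F by (auto simp: balanced_def)
  have F0: "F 0 z = 0" "F z 0 = 0" for z
    using add(1)[of 0 0 z] add(2)[of z 0 0] by auto
  have scale: "F (s c x) y = F x (s c y)" for c x y
    using F by (auto simp: balanced_def)
  have "sum_list (map W a) = sum_list (map W b)" if "tensor_eq s a b" for a b
    using that
  proof induction
    case (comm t u)
    then show ?case by (simp add: add.commute)
  next
    case (zero p q)
    show ?case
      by (auto simp: W_def F0 Cons_eq_append_conv append_eq_Cons_conv split: list.splits)
  next
    case (add p x y q)
    show ?case
      using \<open>\<And>x y z. F (x + y) z = F x z + F y z\<close> \<open>\<And>x y z. F z (x + y) = F z x + F z y\<close>
      by (cases p; cases q) (auto simp: W_def split: list.splits)
  next
    case (scale p c x q y r)
    show ?case
      using \<open>\<And>c x y. F (s c x) y = F x (s c y)\<close>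
      by (cases p; cases q; cases r) (auto simp: W_def split: list.splits)
  qed simp_all
  from this[of "map (\<lambda>(x, y). [x, y]) t" "map (\<lambda>(x, y). [x, y]) u"] assms(2)
  show ?thesis
    by (simp add: tensor2_eq_iff_map W_def comp_def split_def)
qed

text \<open>
  The map \<open>f \<otimes> g\<close> of tensor squares is well defined. As in the previous proof words of other
  lengths are discarded.
\<close>

lemma tensor2_eq_map_prod:
  assumes f: "Vector_Spaces.linear s s' f" and g: "Vector_Spaces.linear s s' g"
    and "tensor2_eq s t u"
  shows "tensor2_eq s' (map (\<lambda>(x, y). (f x, g y)) t) (map (\<lambda>(x, y). (f x, g y)) u)"
proof -
  define W where "W = (\<lambda>w. case w of [x, y] \<Rightarrow> [[f x, g y]] | _ \<Rightarrow> [])"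
  note lin = linear_simps[OF f] linear_simps[OF g]
  have "tensor_eq s' (concat (map W a)) (concat (map W b))" if "tensor_eq s a b" for a b
    using that
  proof induction
    case (sym t u)
    from sym(2) show ?case by (rule tensor_eq.sym)
  next
    case (trans t u v)
    from trans(3,4) show ?case by (rule tensor_eq.trans)
  next
    case (zero p q)
    show ?case
      using tensor_eq.zero[of s' "[]"] tensor_eq.zero[of s' "[f (hd p)]" "[]"]
      by (cases p; cases q) (auto simp: W_def lin tensor_eq.refl split: list.splits)
  next
    case (add p x y q)
    show ?case
      using tensor_eq.add[of s' "[]"] tensor_eq.add[of s' "[f (hd p)]" _ _ "[]"]
      by (cases p; cases q) (auto simp: W_def lin tensor_eq.refl split: list.splits)
  next
    case (scale p c x q y r)
    show ?case
      using tensor_eq.scale[of s' "[]" c _ "[]" _ "[]"]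
      by (cases p; cases q; cases r) (auto simp: W_def lin tensor_eq.refl split: list.splits)
  qed (simp_all add: tensor_eq.refl tensor_eq.comm tensor_eq.sum)
  from this[of "map (\<lambda>(x, y). [x, y]) t" "map (\<lambda>(x, y). [x, y]) u"] assms(3)
  have "tensor_eq s' (concat (map (\<lambda>(x, y). [[f x, g y]]) t)) (concat (map (\<lambda>(x, y). [[f x, g y]]) u))"
    by (simp add: tensor2_eq_iff_map W_def comp_def split_def)
  moreover have "concat (map (\<lambda>(x, y). [[f x, g y]]) v) = map (\<lambda>(x, y). [x, y]) (map (\<lambda>(x, y). (f x, g y)) v)" for v
    by (induction v) auto
  ultimately show ?thesis
    by (simp add: tensor2_eq_iff_map)
qed

lemma mset_comprehension_swap:
  "mset [F x y. x \<leftarrow> t, y \<leftarrow> u] = mset [F x y. y \<leftarrow> u, x \<leftarrow> t]"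
proof (induction t)
  case (Cons a t)
  have "mset [F x y. y \<leftarrow> u, x \<leftarrow> a # t] = mset (map (F a) u) + mset [F x y. y \<leftarrow> u, x \<leftarrow> t]"
    by (induction u) auto
  with Cons show ?case by simp
qed simp

text \<open>
  For a fixed term of one factor the terms of the other are mapped by a tensor product of two linear
  maps. So the inner formal sum can be replaced, and after interchanging the two loops also the
  outer one.
\<close>

lemma tensor2_eq_bilinear_images:
  assumes f: "bilinear_map s1 s2 s3 f" and g: "bilinear_map s1 s2 s3 g"
    and t: "tensor2_eq s1 t t'" and u: "tensor2_eq s2 u u'"
  shows "tensor2_eq s3 [(f x1 y1, g x2 y2). (x1, x2) \<leftarrow> t, (y1, y2) \<leftarrow> u]
           [(f x1 y1, g x2 y2). (x1, x2) \<leftarrow> t', (y1, y2) \<leftarrow> u']"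
proof -
  let ?F = "\<lambda>x y. (f (fst x) (fst y), g (snd x) (snd y))"
  have "tensor2_eq s3 [?F x y. x \<leftarrow> t, y \<leftarrow> u] [?F x y. x \<leftarrow> t, y \<leftarrow> u']"
    using f g tensor2_eq_map_prod[OF _ _ u, of s3 "f (fst x)" "g (snd x)" for x]
    by (intro tensor2_eq_concat_map) (simp add: bilinear_map_def split_def)
  also have "tensor2_eq s3 [?F x y. x \<leftarrow> t, y \<leftarrow> u'] [?F x y. y \<leftarrow> u', x \<leftarrow> t]"
    by (intro tensor2_eq_permute mset_comprehension_swap)
  also have "tensor2_eq s3 [?F x y. y \<leftarrow> u', x \<leftarrow> t] [?F x y. y \<leftarrow> u', x \<leftarrow> t']"
    using f g tensor2_eq_map_prod[OF _ _ t, of s3 "\<lambda>x. f x (fst y)" "\<lambda>x. g x (snd y)" for y]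
    by (intro tensor2_eq_concat_map) (simp add: bilinear_map_def split_def)
  also have "tensor2_eq s3 [?F x y. y \<leftarrow> u', x \<leftarrow> t'] [?F x y. x \<leftarrow> t', y \<leftarrow> u']"
    by (intro tensor2_eq_permute mset_comprehension_swap[symmetric])
  finally show ?thesis
    by (simp add: split_def)
qed


section \<open>Sweedler sums over primitive elements\<close>

lemma Prim_iff: "x \<in> lcarrier (Prim A) \<longleftrightarrow> tensor2_eq (smul A) (coprod A x) [(x, 1), (1, x)]"
  by (simp add: Prim_def)

lemma Prim_simps [simp]: "lscale (Prim A) = smul A" "bracket (Prim A) = (\<lambda>x y. x * y - y * x)"
  by (simp_all add: Prim_def)

lemma sum_list_concat_map: "(\<Sum>p\<leftarrow>concat (map f t). g p) = (\<Sum>x\<leftarrow>t. \<Sum>p\<leftarrow>f x. g p)"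
  by (induction t) simp_all

text \<open>
  Trilinearity up to moving scalars: the scalar moves between neighbouring slots, hence between any
  two.
\<close>

definition balanced3 ::
  "('k \<Rightarrow> 'a::ab_group_add \<Rightarrow> 'a) \<Rightarrow> ('a \<Rightarrow> 'a \<Rightarrow> 'a \<Rightarrow> 'b::ab_group_add) \<Rightarrow> bool" where
  "balanced3 s F \<longleftrightarrow> (\<forall>x. balanced s (F x)) \<and> (\<forall>z. balanced s (\<lambda>x y. F x y z))"

context bialgebra
begin

lemma smul_simps:
  "smul A c 0 = 0" "smul A c (x + y) = smul A c x + smul A c y" "smul A c (- x) = - smul A c x"
  "smul A c (x - y) = smul A c x - smul A c y"
  "smul A 0 x = 0" "smul A 1 x = x" "smul A (- c) x = - smul A c x"
  "smul A c x * y = smul A c (x * y)" "x * smul A c y = smul A c (x * y)"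
proof -
  interpret vector_space "smul A" by (rule vector_space)
  show "smul A c 0 = 0" "smul A c (x + y) = smul A c x + smul A c y" "smul A c (- x) = - smul A c x"
  "smul A c (x - y) = smul A c x - smul A c y"
    "smul A 0 x = 0" "smul A 1 x = x" "smul A (- c) x = - smul A c x"
    by (simp_all add: scale_right_distrib scale_right_diff_distrib)
  show "smul A c x * y = smul A c (x * y)" "x * smul A c y = smul A c (x * y)"
    using smul_mult_left smul_mult_right by metis+
qed

lemma smul_sum_list: "smul A c (\<Sum>p\<leftarrow>t. f p) = (\<Sum>p\<leftarrow>t. smul A c (f p))"
  by (induction t) (simp_all add: smul_simps)

lemma mult_bilinear: "bilinear_map (smul A) (smul A) (smul A) (*)"
  using vector_space by (simp add: bilinear_map_def Vector_Spaces.linear_iff smul_simps algebra_simps)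

lemma sum_coprod_add:
  "balanced (smul A) F \<Longrightarrow> (\<Sum>(a, b)\<leftarrow>coprod A (x + y). F a b) =
     (\<Sum>(a, b)\<leftarrow>coprod A x. F a b) + (\<Sum>(a, b)\<leftarrow>coprod A y. F a b)"
  using balanced_sum_eq[OF _ coprod_add] by simp

lemma sum_coprod_smul:
  "balanced (smul A) F \<Longrightarrow> (\<Sum>(a, b)\<leftarrow>coprod A (smul A c x). F a b) =
     (\<Sum>(a, b)\<leftarrow>coprod A x. F (smul A c a) b)"
  using balanced_sum_eq[OF _ coprod_smul] by (simp add: comp_def split_def)

lemma sum_coprod_one: "balanced (smul A) F \<Longrightarrow> (\<Sum>(a, b)\<leftarrow>coprod A 1. F a b) = F 1 1"
  using balanced_sum_eq[OF _ coprod_one] by simp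

lemma sum_coprod_Prim:
  "x \<in> lcarrier (Prim A) \<Longrightarrow> balanced (smul A) F \<Longrightarrow>
     (\<Sum>(a, b)\<leftarrow>coprod A x. F a b) = F x 1 + F 1 x"
  using balanced_sum_eq[of "smul A" F "coprod A x"] by (simp add: Prim_iff)

lemma sum_coprod3_Prim:
  assumes x: "x \<in> lcarrier (Prim A)" and F: "balanced3 (smul A) F"
  shows "(\<Sum>(a, b, c)\<leftarrow>coprod3 A x. F a b c) = F x 1 1 + F 1 x 1 + F 1 1 x"
proof -
  have bal: "balanced (smul A) (F a)" "balanced (smul A) (\<lambda>a b. F a b c)" for a c
    using F by (auto simp: balanced3_def)
  have "(\<Sum>(a, b, c)\<leftarrow>coprod3 A x. F a b c) =
      (\<Sum>(a, y)\<leftarrow>coprod A x. \<Sum>(b, c)\<leftarrow>coprod A y. F a b c)"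
    by (simp add: coprod3_def sum_list_concat_map comp_def split_def)
  \<comment> \<open>the inner sum is itself balanced in the first leg and the argument of the inner coproduct\<close>
  also have "\<dots> = (\<Sum>(b, c)\<leftarrow>coprod A 1. F x b c) + (\<Sum>(b, c)\<leftarrow>coprod A x. F 1 b c)"
  proof (rule sum_coprod_Prim[OF x balancedI])
    fix a a' y
    show "(\<Sum>(b, c)\<leftarrow>coprod A y. F (a + a') b c) =
      (\<Sum>(b, c)\<leftarrow>coprod A y. F a b c) + (\<Sum>(b, c)\<leftarrow>coprod A y. F a' b c)"
      using bal(2) by (simp add: balanced_def split_def sum_list_addf)
    show "(\<Sum>(b, c)\<leftarrow>coprod A (x + y). F a b c) =
      (\<Sum>(b, c)\<leftarrow>coprod A x. F a b c) + (\<Sum>(b, c)\<leftarrow>coprod A y. F a b c)" for x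
      by (rule sum_coprod_add[OF bal(1)])
    show "(\<Sum>(b, c)\<leftarrow>coprod A y. F (smul A k a) b c) = (\<Sum>(b, c)\<leftarrow>coprod A (smul A k y). F a b c)" for k
      unfolding sum_coprod_smul[OF bal(1)] using bal(2) by (simp add: balanced_def)
  qed
  finally show ?thesis
    using sum_coprod_Prim[OF x bal(1)] by (simp add: sum_coprod_one bal(1) add.assoc)
qed

text \<open>
  The counit law at \<open>x\<close> reads \<open>\<epsilon>(x) 1 + x = x\<close>; applying the counit to \<open>\<epsilon>(x) 1 = 0\<close> gives the
  claim.
\<close>

lemma counit_Prim:
  assumes "x \<in> lcarrier (Prim A)"
  shows "counit A x = 0"
proof -
  have "balanced (smul A) (\<lambda>a b. smul A (counit A a) b)"
    using linear_simps[OF counit_linear] vector_space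
    by (intro balancedI) (simp_all add: vector_space_def algebra_simps)
  from sum_coprod_Prim[OF assms this] have "smul A (counit A x) 1 = 0"
    by (simp add: counit_left counit_one smul_simps)
  then have "counit A (smul A (counit A x) 1) = 0"
    using linear_simps[OF counit_linear] by simp
  then show ?thesis
    using linear_simps(5)[OF counit_linear] by (simp add: counit_one)
qed

section \<open>The Lie algebra of primitive elements\<close>

lemma Prim_zero: "0 \<in> lcarrier (Prim A)"
proof -
  have lin: "Vector_Spaces.linear (smul A) (smul A) (smul A 0)"
    "Vector_Spaces.linear (smul A) (smul A) (\<lambda>x. x)"
    using vector_space by (auto simp: Vector_Spaces.linear_iff smul_simps)
  have "tensor2_eq (smul A) (coprod A 0) (map (\<lambda>(x1, x2). (smul A 0 x1, x2)) (coprod A 1))"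
    \<comment> \<open>\<open>0\<close> is written as \<open>0 \<cdot> 1\<close> since the coproduct of \<open>1\<close> is known explicitly\<close>
    using coprod_smul[of 0 1] by (simp add: smul_simps)
  also have "tensor2_eq (smul A) \<dots> (map (\<lambda>(x1, x2). (smul A 0 x1, x2)) [(1, 1)])"
    by (intro tensor2_eq_map_prod[OF lin] coprod_one)
  also have "tensor2_eq (smul A) \<dots> ([(0, 1)] @ [(1, 0)])"
    by (simp add: smul_simps tensor2_eq_Cons tensor2_eq_sym[OF tensor2_eq_zero_right])
  finally show ?thesis by (simp add: Prim_iff)
qed

lemma Prim_add:
  assumes "x \<in> lcarrier (Prim A)" "y \<in> lcarrier (Prim A)"
  shows "x + y \<in> lcarrier (Prim A)"
proof -
  have "tensor2_eq (smul A) (coprod A (x + y)) (coprod A x @ coprod A y)"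
    by (rule coprod_add)
  also have "tensor2_eq (smul A) \<dots> ([(x, 1), (1, x)] @ [(y, 1), (1, y)])"
    using assms by (intro tensor2_eq_append) (simp_all add: Prim_iff)
  also have "tensor2_eq (smul A) \<dots> ([(x, 1), (y, 1)] @ [(1, x), (1, y)])"
    by (rule tensor2_eq_permute) simp
  also have "tensor2_eq (smul A) \<dots> ([(x + y, 1)] @ [(1, x + y)])"
    by (intro tensor2_eq_append tensor2_eq_sym[OF tensor2_eq_add_left]
        tensor2_eq_sym[OF tensor2_eq_add_right])
  finally show ?thesis by (simp add: Prim_iff)
qed

lemma Prim_smul:
  assumes "x \<in> lcarrier (Prim A)"
  shows "smul A c x \<in> lcarrier (Prim A)"
proof -
  have lin: "Vector_Spaces.linear (smul A) (smul A) (smul A c)"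
    "Vector_Spaces.linear (smul A) (smul A) (\<lambda>x. x)"
    using vector_space by (auto simp: Vector_Spaces.linear_iff vector_space_def mult.commute)
  have "tensor2_eq (smul A) (coprod A (smul A c x)) (map (\<lambda>(x1, x2). (smul A c x1, x2)) (coprod A x))"
    by (rule coprod_smul)
  also have "tensor2_eq (smul A) \<dots> (map (\<lambda>(x1, x2). (smul A c x1, x2)) [(x, 1), (1, x)])"
    using assms by (intro tensor2_eq_map_prod[OF lin]) (simp add: Prim_iff)
  also have "tensor2_eq (smul A) \<dots> [(smul A c x, 1), (1, smul A c x)]"
    by (simp add: tensor2_eq_Cons tensor2_eq_scale)
  finally show ?thesis by (simp add: Prim_iff)
qed

lemma Prim_uminus: "x \<in> lcarrier (Prim A) \<Longrightarrow> - x \<in> lcarrier (Prim A)"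
  using Prim_smul[of x "- 1"] by (simp add: smul_simps)

lemma coprod_mult_Prim:
  assumes "x \<in> lcarrier (Prim A)" "y \<in> lcarrier (Prim A)"
  shows "tensor2_eq (smul A) (coprod A (x * y)) [(x * y, 1), (x, y), (y, x), (1, x * y)]"
proof -
  have "tensor2_eq (smul A) (coprod A (x * y))
      [(x1 * y1, x2 * y2). (x1, x2) \<leftarrow> [(x, 1), (1, x)], (y1, y2) \<leftarrow> [(y, 1), (1, y)]]"
    by (rule tensor2_eq_trans[OF coprod_mult tensor2_eq_bilinear_images[OF mult_bilinear mult_bilinear
            assms[unfolded Prim_iff]]])
  then show ?thesis by simp
qed

text \<open>
  Writing \<open>xy - yx\<close> as \<open>xy + (-y)x\<close> reduces this to coproducts of products of primitive elements,
  whose mixed terms \<open>y \<otimes> x\<close>, \<open>(-y) \<otimes> x\<close> and \<open>x \<otimes> y\<close>, \<open>x \<otimes> (-y)\<close> cancel.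
\<close>

lemma Prim_commutator:
  assumes x: "x \<in> lcarrier (Prim A)" and y: "y \<in> lcarrier (Prim A)"
  shows "x * y - y * x \<in> lcarrier (Prim A)"
proof -
  have cancel: "tensor2_eq (smul A) [(u, v), (- u, v)] []" for u v
    using tensor2_eq_trans[OF tensor2_eq_sym[OF tensor2_eq_add_left[of _ u "- u" v]]]
      tensor2_eq_zero_left[of "smul A" v] by simp
  have "tensor2_eq (smul A) (coprod A (x * y - y * x)) (coprod A (x * y) @ coprod A ((- y) * x))"
    using coprod_add[of "x * y" "- y * x"] by simp
  also have "tensor2_eq (smul A) \<dots> ([(x * y, 1), (x, y), (y, x), (1, x * y)] @
      [((- y) * x, 1), (- y, x), (x, - y), (1, (- y) * x)])"
    by (intro tensor2_eq_append coprod_mult_Prim x y Prim_uminus)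
  also have "tensor2_eq (smul A) \<dots> ([(x * y, 1), ((- y) * x, 1)] @ [(1, x * y), (1, (- y) * x)]
      @ [(y, x), (- y, x)] @ [(x, y), (x, - y)])"
    by (rule tensor2_eq_permute) simp
  also have "tensor2_eq (smul A) \<dots> ([(x * y + (- y) * x, 1)] @ [(1, x * y + (- y) * x)] @ [] @ [(x, y + - y)])"
    by (intro tensor2_eq_append cancel tensor2_eq_sym[OF tensor2_eq_add_left]
        tensor2_eq_sym[OF tensor2_eq_add_right])
  also have "tensor2_eq (smul A) \<dots> ([(x * y + (- y) * x, 1)] @ [(1, x * y + (- y) * x)] @ [] @ [])"
    using tensor2_eq_zero_right by (intro tensor2_eq_append) auto
  finally show ?thesis by (simp add: Prim_iff)
qed

lemma lie_algebra_Prim: "lie_algebra (Prim A)"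
proof -
  interpret vector_space "smul A" by (rule vector_space)
  show ?thesis
    by unfold_locales
      (simp_all add: lie_bilinear_def lie_linear_def Prim_zero Prim_add Prim_smul Prim_commutator
        subspace_def smul_simps algebra_simps)
qed

end

context cocomm_hopf_algebra
begin

lemma antipode_one: "antipode A 1 = 1"
proof -
  have "balanced (smul A) (\<lambda>a b. antipode A a * b)"
    by (intro balancedI) (simp_all add: linear_simps[OF antipode_linear] smul_simps algebra_simps)
  from sum_coprod_one[OF this] show ?thesis
    by (simp add: antipode_left counit_one smul_simps)
qed

lemma antipode_Prim:
  assumes "x \<in> lcarrier (Prim A)"
  shows "antipode A x = - x"
proof -
  have "balanced (smul A) (\<lambda>a b. antipode A a * b)"
    by (intro balancedI) (simp_all add: linear_simps[OF antipode_linear] smul_simps algebra_simps)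
  from sum_coprod_Prim[OF assms this] show ?thesis
    by (simp add: antipode_left antipode_one counit_Prim[OF assms] smul_simps eq_neg_iff_add_eq_0)
qed

lemma balanced_ad: "balanced (smul A) (\<lambda>a b. a * y * antipode A b)"
  by (intro balancedI) (simp_all add: linear_simps[OF antipode_linear] smul_simps algebra_simps)

lemma ad_bilinear: "bilinear_map (smul A) (smul A) (smul A) (ad A)"
proof -
  have "ad A (x + x') y = ad A x y + ad A x' y" "ad A (smul A c x) y = smul A c (ad A x y)" for c x x' y
    unfolding ad_def sum_coprod_add[OF balanced_ad] sum_coprod_smul[OF balanced_ad]
    by (simp_all add: smul_sum_list smul_simps split_def)
  moreover have "ad A x (y + y') = ad A x y + ad A x y'" "ad A x (smul A c y) = smul A c (ad A x y)" for c x y y'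
    by (simp_all add: ad_def smul_sum_list smul_simps split_def sum_list_addf[symmetric] distrib_left distrib_right)
  ultimately show ?thesis
    using vector_space by (simp add: bilinear_map_def Vector_Spaces.linear_iff)
qed

lemma ad_one_left: "ad A 1 y = y"
  unfolding ad_def by (simp add: sum_coprod_one[OF balanced_ad] antipode_one)

lemma ad_Prim: "x \<in> lcarrier (Prim A) \<Longrightarrow> ad A x y = x * y - y * x"
  unfolding ad_def by (simp add: sum_coprod_Prim[OF _ balanced_ad] antipode_one antipode_Prim)

end

section \<open>Morphisms and actions on primitive elements\<close>

lemma (in hopf_hom) lie_hom_Prim: "lie_hom (Prim A) (Prim B) f"
proof -
  have closed: "f x \<in> lcarrier (Prim B)" if "x \<in> lcarrier (Prim A)" for x
    using tensor2_eq_trans[OF coprod tensor2_eq_map_prod[OF linear linear that[unfolded Prim_iff]]]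
    by (simp add: Prim_iff one)
  interpret A: lie_algebra "Prim A" by (rule A.lie_algebra_Prim)
  interpret B: lie_algebra "Prim B" by (rule B.lie_algebra_Prim)
  show ?thesis
    by unfold_locales (simp_all add: lie_linear_def closed linear_simps[OF linear] mult)
qed

text \<open>
  The coproduct of \<open>f x y\<close> has four terms, two of which contain the factor \<open>f x 1 = 0\<close>.
\<close>

lemma Prim_bilinear_image:
  assumes f: "bilinear_map (smul A) (smul B) (smul C) f"
    and coprod: "tensor2_eq (smul C) (coprod C (f x y))
          [(f x1 y1, f x2 y2). (x1, x2) \<leftarrow> coprod A x, (y1, y2) \<leftarrow> coprod B y]"
    and one: "f 1 1 = 1" and x1: "f x 1 = 0"
    and x: "x \<in> lcarrier (Prim A)" and y: "y \<in> lcarrier (Prim B)"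
  shows "f x y \<in> lcarrier (Prim C)"
proof -
  note coprod
  also have "tensor2_eq (smul C) [(f x1 y1, f x2 y2). (x1, x2) \<leftarrow> coprod A x, (y1, y2) \<leftarrow> coprod B y]
      [(f x1 y1, f x2 y2). (x1, x2) \<leftarrow> [(x, 1), (1, x)], (y1, y2) \<leftarrow> [(y, 1), (1, y)]]"
    by (rule tensor2_eq_bilinear_images[OF f f x[unfolded Prim_iff] y[unfolded Prim_iff]])
  also have "\<dots> = [(f x y, 1)] @ [(0, f 1 y)] @ [(f 1 y, 0)] @ [(1, f x y)]"
    by (simp add: one x1)
  also have "tensor2_eq (smul C) \<dots> ([(f x y, 1)] @ [] @ [] @ [(1, f x y)])"
    by (intro tensor2_eq_append tensor2_eq_refl tensor2_eq_zero_left tensor2_eq_zero_right)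
  finally show ?thesis by (simp add: Prim_iff)
qed

lemma lie_bilinear_Prim:
  assumes "bilinear_map (smul A) (smul B) (smul C) f"
    and "\<And>x y. x \<in> lcarrier (Prim A) \<Longrightarrow> y \<in> lcarrier (Prim B) \<Longrightarrow> f x y \<in> lcarrier (Prim C)"
  shows "lie_bilinear (Prim A) (Prim B) (Prim C) f"
  using assms by (simp add: lie_bilinear_def lie_linear_def bilinear_simps[OF assms(1)])

context module_bialgebra
begin

lemma act_one_Prim: "x \<in> lcarrier (Prim H) \<Longrightarrow> act x 1 = 0"
  by (simp add: act_one H.counit_Prim I.smul_simps)

lemma act_Prim:
  "x \<in> lcarrier (Prim H) \<Longrightarrow> v \<in> lcarrier (Prim I) \<Longrightarrow> act x v \<in> lcarrier (Prim I)"
  by (rule Prim_bilinear_image[OF act_bilinear act_coprod]) (simp_all add: one_act act_one_Prim)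

lemma act_mult_Prim:
  assumes "x \<in> lcarrier (Prim H)"
  shows "act x (u * v) = act x u * v + u * act x v"
proof -
  have "balanced (smul H) (\<lambda>a b. act a u * act b v)"
    by (intro balancedI) (simp_all add: bilinear_simps[OF act_bilinear] I.smul_simps algebra_simps)
  from H.sum_coprod_Prim[OF assms this] show ?thesis
    by (simp add: act_mult one_act)
qed

lemma lie_action_Prim: "lie_action (Prim H) (Prim I) act"
proof -
  interpret G: lie_algebra "Prim H" by (rule H.lie_algebra_Prim)
  interpret E: lie_algebra "Prim I" by (rule I.lie_algebra_Prim)
  show ?thesis
    by unfold_locales
      (simp_all add: lie_bilinear_Prim[OF act_bilinear] act_Prim mult_act act_mult_Prim
        bilinear_simps[OF act_bilinear])
qed

end

section \<open>The Peiffer lifting on primitive elements\<close>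

context hopf_two_crossed_module
begin

interpretation act': hopf_crossed_module K I d2 "lifting_action K d2 lift"
  by (rule lifting_action_crossed_module)

abbreviation act' where "act' \<equiv> lifting_action K d2 lift"

text \<open>
  As rewrite rules these move every scalar to the front of an expression and distribute the structure
  maps over sums, which proves that a Sweedler summand is balanced.
\<close>

lemmas linear_rules =
  linear_simps[OF d2.linear] linear_simps[OF d1.linear]
  linear_simps[OF d2.A.antipode_linear] linear_simps[OF d2.B.antipode_linear]
  bilinear_simps[OF actI.act_bilinear] bilinear_simps[OF actK.act_bilinear]
  bilinear_simps[OF lift_bilinear] bilinear_simps[OF act'.act_bilinear]
  bilinear_simps[OF d2.A.ad_bilinear] bilinear_simps[OF d2.B.ad_bilinear]
  d2.A.smul_simps d2.B.smul_simps d1.B.smul_simps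
  d1.B.counit_one

lemma lift_one_one: "lift 1 1 = 1"
proof -
  have "balanced (smul K) (\<lambda>a b. ad K 1 a * antipode K b)"
    by (intro balancedI) (simp_all add: linear_rules algebra_simps)
  from d2.A.sum_coprod_one[OF this] show ?thesis
    using lift_d2_d2[of 1 1] by (simp add: d2.one d2.A.ad_one_left d2.A.antipode_one)
qed

text \<open>
  In the formula for \<open>{x, 1 \<cdot> 1}\<close> the element \<open>x\<close> sits in one of three legs. In the first and in the
  last leg it contributes \<open>{x, 1}\<close>; in the middle one it acts on \<open>1\<close> and contributes \<open>0\<close>.
\<close>

lemma lift_one_right_Prim:
  assumes x: "x \<in> lcarrier (Prim I)"
  shows "lift x 1 = 0"
proof -
  have bal: "balanced (smul I) (\<lambda>b1 b2. lift a1 b1 * act' (actI (d1 a2) b2) (lift a3 1))" for a1 a2 a3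
    by (intro balancedI) (simp_all add: linear_rules algebra_simps)
  have bal3: "balanced3 (smul I) (\<lambda>a1 a2 a3. lift a1 1 * act' (actI (d1 a2) 1) (lift a3 1))"
    unfolding balanced3_def
    by (intro conjI allI balancedI) (simp_all add: linear_rules algebra_simps)
  have "lift x 1 = (\<Sum>(a1, a2, a3)\<leftarrow>coprod3 I x. lift a1 1 * act' (actI (d1 a2) 1) (lift a3 1))"
    using lift_mult_right[of x 1 1] by (simp add: d2.B.sum_coprod_one[OF bal])
  also have "\<dots> = lift x 1 + lift x 1"
    unfolding d2.B.sum_coprod3_Prim[OF x bal3]
    by (simp add: d1.one lift_one_one actI.one_act actI.act_one d1.counit d2.B.counit_Prim[OF x]
        act'.one_act linear_rules)
  finally show ?thesis by simp
qed

text \<open>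
  At \<open>k = 1\<close> the symmetry axiom reads \<open>{1, x} + {x, 1} = \<partial>\<^sub>1(x) \<rhd> 1 = 0\<close>.
\<close>

lemma lift_one_left_Prim:
  assumes x: "x \<in> lcarrier (Prim I)"
  shows "lift 1 x = 0"
proof -
  have bal: "balanced (smul K) (\<lambda>k1 k2. \<Sum>(x1, x2)\<leftarrow>coprod I x. lift (d2 k1) x1 * lift x2 (d2 k2))"
    "balanced (smul K) (\<lambda>k1 k2. k1 * actK (d1 x) (antipode K k2))"
    "balanced (smul I) (\<lambda>x1 x2. lift 1 x1 * lift x2 1)"
    by (intro balancedI; simp add: linear_rules algebra_simps split_def sum_list_addf)+
  have "lift 1 x * lift 1 1 + lift 1 1 * lift x 1 = actK (d1 x) 1"
    using lift_d2_sym[of x 1]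
    by (simp add: d2.A.sum_coprod_one[OF bal(1)] d2.A.sum_coprod_one[OF bal(2)]
        d2.B.sum_coprod_Prim[OF x bal(3)] d2.one d2.A.antipode_one)
  then show ?thesis
    by (simp add: lift_one_one lift_one_right_Prim[OF x] actK.act_one d1.counit
        d2.B.counit_Prim[OF x] linear_rules)
qed

lemma lift_Prim:
  "x \<in> lcarrier (Prim I) \<Longrightarrow> y \<in> lcarrier (Prim I) \<Longrightarrow> lift x y \<in> lcarrier (Prim K)"
  by (rule Prim_bilinear_image[OF lift_bilinear lift_coprod])
    (simp_all add: lift_one_one lift_one_right_Prim)

lemma lifting_action_Prim:
  assumes "k \<in> lcarrier (Prim K)" "x \<in> lcarrier (Prim I)"
  shows "act' x k = - lift (d2 k) x"
proof -
  have "balanced (smul K) (\<lambda>a b. a * lift (d2 (antipode K b)) x)"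
    by (intro balancedI) (simp_all add: linear_rules algebra_simps)
  from d2.A.sum_coprod_Prim[OF assms(1) this] show ?thesis
    by (simp add: lifting_action_def d2.one d2.A.antipode_one d2.A.antipode_Prim assms
        lift_one_left_Prim linear_rules)
qed

lemma lift_equivariant_Prim:
  assumes "g \<in> lcarrier (Prim H)"
  shows "actK g (lift u v) = lift (actI g u) v + lift u (actI g v)"
proof -
  have "balanced (smul H) (\<lambda>a b. lift (actI a u) (actI b v))"
    by (intro balancedI) (simp_all add: linear_rules)
  from d1.B.sum_coprod_Prim[OF assms this] show ?thesis
    by (simp add: lift_equivariant actI.one_act)
qed

lemma d2_lift_Prim:
  assumes u: "u \<in> lcarrier (Prim I)" and v: "v \<in> lcarrier (Prim I)"
  shows "d2 (lift u v) = u * v - v * u - actI (d1 u) v"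
proof -
  have bal: "balanced (smul I) (\<lambda>v1 v2. ad I u1 v1 * actI (d1 u2) (antipode I v2))" for u1 u2
    by (intro balancedI) (simp_all add: linear_rules algebra_simps)
  have bal': "balanced (smul I) (\<lambda>u1 u2. ad I u1 v * actI (d1 u2) (antipode I 1) + ad I u1 1 * actI (d1 u2) (antipode I v))"
    by (intro balancedI) (simp_all add: linear_rules algebra_simps)
  show ?thesis
    unfolding d2_lift d2.B.sum_coprod_Prim[OF v bal] d2.B.sum_coprod_Prim[OF u bal']
    by (simp add: d2.B.antipode_one d2.B.antipode_Prim u v d1.one actI.one_act actI.act_one d1.counit
        d2.B.counit_Prim d2.B.ad_one_left d2.B.ad_Prim linear_rules)
qed

lemma lift_d2_d2_Prim:
  assumes "k \<in> lcarrier (Prim K)" "l \<in> lcarrier (Prim K)"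
  shows "lift (d2 k) (d2 l) = k * l - l * k"
proof -
  have "balanced (smul K) (\<lambda>a b. ad K k a * antipode K b)"
    by (intro balancedI) (simp_all add: linear_rules algebra_simps)
  from d2.A.sum_coprod_Prim[OF assms(2) this] show ?thesis
    by (simp add: lift_d2_d2 d2.A.ad_Prim d2.A.antipode_one assms)
qed

text \<open>
  The legs of \<open>x\<close> and \<open>y\<close> give six terms \<open>{x', y'} ((\<partial>\<^sub>1(x'') \<rhd> y'') \<rhd>' {x''', z})\<close>. If \<open>x\<close> is not
  in the third leg, the last factor contains \<open>{1, z} = 0\<close>; if \<open>x\<close> is in the third leg and \<open>y\<close> in the
  first one, the first factor is \<open>{1, y} = 0\<close>. What remains is \<open>y \<rhd>' {x, z}\<close>.
\<close>

lemma lift_mult_right_Prim: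
  assumes x: "x \<in> lcarrier (Prim I)" and y: "y \<in> lcarrier (Prim I)" and z: "z \<in> lcarrier (Prim I)"
  shows "lift x (y * z) = - lift (d2 (lift x z)) y"
proof -
  have bal: "balanced (smul I) (\<lambda>b1 b2. lift a1 b1 * act' (actI (d1 a2) b2) (lift a3 z))" for a1 a2 a3
    by (intro balancedI) (simp_all add: linear_rules algebra_simps)
  have bal3: "balanced3 (smul I) (\<lambda>a1 a2 a3. lift a1 y * act' (actI (d1 a2) 1) (lift a3 z) +
      lift a1 1 * act' (actI (d1 a2) y) (lift a3 z))"
    unfolding balanced3_def
    by (intro conjI allI balancedI) (simp_all add: linear_rules algebra_simps)
  show ?thesis
    unfolding lift_mult_right d2.B.sum_coprod_Prim[OF y bal] d2.B.sum_coprod3_Prim[OF x bal3]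
    by (simp add: lift_one_one lift_one_left_Prim lift_one_right_Prim x y z d1.one actI.one_act
        lifting_action_Prim lift_Prim linear_rules)
qed

text \<open>
  In the terms \<open>{x', ad(y') z'} (\<partial>\<^sub>1(x'') \<rhd> {y'', z''})\<close> the factor \<open>{y'', z''}\<close> is nonzero only if
  \<open>y\<close> and \<open>z\<close> are in the same leg, so the pair contributes either \<open>[y, z]\<close> to the first factor or
  \<open>{y, z}\<close> to the second. The position of \<open>x\<close> is then forced, as \<open>\<partial>\<^sub>1(x) \<rhd> 1 = 0\<close> and
  \<open>{x, 1} = 0\<close>.
\<close>

lemma lift_mult_left_Prim:
  assumes x: "x \<in> lcarrier (Prim I)" and y: "y \<in> lcarrier (Prim I)" and z: "z \<in> lcarrier (Prim I)"
  shows "lift (x * y) z = lift x (y * z - z * y) + actK (d1 x) (lift y z)"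
proof -
  have balz: "balanced (smul I) (\<lambda>z1 z2. lift x1 (ad I y1 z1) * actK (d1 x2) (lift y2 z2))"
    for x1 x2 y1 y2
    by (intro balancedI) (simp_all add: linear_rules algebra_simps)
  have baly: "balanced (smul I) (\<lambda>y1 y2. lift x1 (ad I y1 z) * actK (d1 x2) (lift y2 1) +
      lift x1 (ad I y1 1) * actK (d1 x2) (lift y2 z))" for x1 x2
    by (intro balancedI) (simp_all add: linear_rules algebra_simps)
  have balx: "balanced (smul I) (\<lambda>x1 x2.
      lift x1 (y * z - z * y) * actK (d1 x2) 1 + lift x1 1 * actK (d1 x2) (lift y z))"
    by (intro balancedI) (simp_all add: linear_rules algebra_simps)
  have "lift (x * y) z = (\<Sum>(x1, x2)\<leftarrow>coprod I x.
      lift x1 (y * z - z * y) * actK (d1 x2) 1 + lift x1 1 * actK (d1 x2) (lift y z))"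
    unfolding lift_mult_left d2.B.sum_coprod_Prim[OF z balz] d2.B.sum_coprod_Prim[OF y baly]
    by (simp add: d2.B.ad_Prim d2.B.ad_one_left y z lift_one_one lift_one_left_Prim
        lift_one_right_Prim linear_rules)
  also have "\<dots> = lift x (y * z - z * y) + actK (d1 x) (lift y z)"
    unfolding d2.B.sum_coprod_Prim[OF x balx]
    by (simp add: lift_one_one lift_one_left_Prim lift_one_right_Prim d2.B.Prim_commutator x y z d1.one
        actK.one_act actK.act_one d1.counit d2.B.counit_Prim linear_rules)
  finally show ?thesis .
qed

lemma lift_d2_sym_Prim:
  assumes k: "k \<in> lcarrier (Prim K)" and x: "x \<in> lcarrier (Prim I)"
  shows "lift (d2 k) x + lift x (d2 k) = - actK (d1 x) k"
proof -
  have d2k: "d2 k \<in> lcarrier (Prim I)"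
    using lie_hom.linear[OF d2.lie_hom_Prim] k by (simp add: lie_linear_def)
  have balx: "balanced (smul I) (\<lambda>x1 x2. lift (d2 k1) x1 * lift x2 (d2 k2))" for k1 k2
    by (intro balancedI) (simp_all add: linear_rules algebra_simps)
  have balk: "balanced (smul K) (\<lambda>k1 k2. lift (d2 k1) x * lift 1 (d2 k2) + lift (d2 k1) 1 * lift x (d2 k2))"
    "balanced (smul K) (\<lambda>k1 k2. k1 * actK (d1 x) (antipode K k2))"
    by (intro balancedI; simp add: linear_rules algebra_simps)+
  show ?thesis
    using lift_d2_sym[of x k]
    unfolding d2.B.sum_coprod_Prim[OF x balx] d2.A.sum_coprod_Prim[OF k balk(1)]
      d2.A.sum_coprod_Prim[OF k balk(2)]
    by (simp add: lift_one_one lift_one_left_Prim lift_one_right_Prim x k d2k d2.one d1.counit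
        d2.B.counit_Prim d2.A.antipode_one d2.A.antipode_Prim actK.act_one linear_rules)
qed

theorem lie_two_crossed_module_Prim:
  "lie_two_crossed_module (Prim K) (Prim I) (Prim H) d2 d1 actI actK lift"
proof -
  interpret P2: lie_hom "Prim K" "Prim I" d2 by (rule d2.lie_hom_Prim)
  interpret P1: lie_hom "Prim I" "Prim H" d1 by (rule d1.lie_hom_Prim)
  interpret PI: lie_action "Prim H" "Prim I" actI by (rule actI.lie_action_Prim)
  interpret PK: lie_action "Prim H" "Prim K" actK by (rule actK.lie_action_Prim)
  show ?thesis
  proof unfold_locales
    show "d1 (d2 x) = 0" if "x \<in> lcarrier (Prim K)" for x
      by (simp add: complex d2.A.counit_Prim[OF that] linear_rules)
    show "lie_bilinear (Prim I) (Prim I) (Prim K) lift"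
      by (rule lie_bilinear_Prim[OF lift_bilinear lift_Prim])
    show "actK g (lift u v) = lift (actI g u) v + lift u (actI g v)" if "g \<in> lcarrier (Prim H)" for g u v
      by (rule lift_equivariant_Prim[OF that])
    show "d1 (actI g u) = bracket (Prim H) g (d1 u)" if "g \<in> lcarrier (Prim H)" for g u
      by (simp add: d1_act d1.B.ad_Prim[OF that])
    fix u v w assume u: "u \<in> lcarrier (Prim I)" and v: "v \<in> lcarrier (Prim I)" and w: "w \<in> lcarrier (Prim I)"
    show "lift u (bracket (Prim I) v w) = lift (d2 (lift u v)) w - lift (d2 (lift u w)) v"
      by (simp add: lift_mult_right_Prim u v w bilinear_simps[OF lift_bilinear])
    show "lift (bracket (Prim I) u v) w = actK (d1 u) (lift v w) + lift u (bracket (Prim I) v w)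
        - actK (d1 v) (lift u w) - lift v (bracket (Prim I) u w)"
      unfolding Prim_simps bilinear_simps(5)[OF lift_bilinear] lift_mult_left_Prim[OF u v w] lift_mult_left_Prim[OF v u w]
      by simp
  qed (simp_all add: d2_act d2_lift_Prim lift_d2_d2_Prim lift_d2_sym_Prim)
qed

end

theorem theorem6p10:
  fixes K :: "('k::field, 'l::ring_1) hopf" and I :: "('k, 'i::ring_1) hopf"
    and H :: "('k, 'h::ring_1) hopf"
    and d2 :: "'l \<Rightarrow> 'i" and d1 :: "'i \<Rightarrow> 'h"
    and actI :: "'h \<Rightarrow> 'i \<Rightarrow> 'i" and actK :: "'h \<Rightarrow> 'l \<Rightarrow> 'l"
    and lift :: "'i \<Rightarrow> 'i \<Rightarrow> 'l"
  assumes "hopf_two_crossed_module K I H d2 d1 actI actK lift"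
  shows "lie_two_crossed_module (Prim K) (Prim I) (Prim H) d2 d1 actI actK lift"
  using assms by (rule hopf_two_crossed_module.lie_two_crossed_module_Prim)

end
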